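(* Let $\mathbb{E}$ be the tetrablock, $\overline{\mathbb{E}}$ its closure, $b\overline{\mathbb{E}}$ its distinguished boundary, and $\Delta(\overline{\mathbb{E}})=\{(x_1,x_2,x_3)\in\overline{\mathbb{E}} : x_1x_2=x_3\}$ the set of triangular points. For $v,\chi\in\mathrm{Aut}(\mathbb{D})$ let $T_{v,\chi}$ be the automorphism of $\mathbb{E}$ (extended to $\overline{\mathbb{E}}$) whose explicit formula is given in the context. Then \[ b\overline{\mathbb{E}}=\{T_{v,\chi}(0,0,1),\ T_{v,\chi}(1,1,1) : v,\chi\in\mathrm{Aut}(\mathbb{D})\}. \] Moreover, \[ b\overline{\mathbb{E}}\cap\Delta(\overline{\mathbb{E}})=\{T_{v,\chi}(1,1,1) : v,\chi\in\mathrm{Aut}(\mathbb{D})\}\quad\text{and}\quad b\overline{\mathbb{E}}\setminus\Delta(\overline{\mathbb{E}})=\{T_{v,\chi}(0,0,1) : v,\chi\in\mathrm{Aut}(\mathbb{D})\}. \]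
   Context: $\mathbb{D}$ is the open unit disc in $\mathbb{C}$ and $\mathbb{T}$ is the unit circle. $\mathrm{Aut}(\mathbb{D})$ is the group of biholomorphic self-maps of $\mathbb{D}$; its elements are exactly the maps $\omega B_\alpha$ with $\omega\in\mathbb{T}$, $\alpha\in\mathbb{D}$, where $B_\alpha(z)=\frac{z-\alpha}{\overline{\alpha}z-1}$. The tetrablock is $\mathbb{E}=\{(a_{11},a_{22},\det A)\in\mathbb{C}^3 : A=[a_{ij}]\in M_2(\mathbb{C}),\ \|A\|<1\}$ (operator norm). Given $v,\chi\in\mathrm{Aut}(\mathbb{D})$, write $v=-\xi_1B_{z_1}$ and $\chi=-\xi_2B_{-\overline{z}_2}$ with $\xi_1,\xi_2\in\mathbb{T}$ and $z_1,z_2\in\mathbb{D}$. Then $T_{v,\chi}=(T_1,T_2,T_3)$ where, for $x=(x_1,x_2,x_3)\in\overline{\mathbb{E}}$, \[ T_1(x)=\xi_1\frac{(x_1-z_1)+\xi_2\overline{z}_2(z_1x_2-x_3)}{(1-\overline{z}_1x_1)-\xi_2\overline{z}_2(x_2-\overline{z}_1x_3)},\qquad T_2(x)=\frac{z_2(\overline{z}_1x_1-1)+\xi_2(x_2-\overline{z}_1x_3)}{(1-\overline{z}_1x_1)-\xi_2\overline{z}_2(x_2-\overline{z}_1x_3)}, \] \[ T_3(x)=\xi_1\frac{z_2(z_1-x_1)-\xi_2(z_1x_2-x_3)}{(1-\overline{z}_1x_1)-\xi_2\overline{z}_2(x_2-\overline{z}_1x_3)}. \] For a bounded domain $\Omega\subset\mathbb{C}^n$,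 $A(\Omega)$ is the algebra of continuous functions on $\overline{\Omega}$ that are holomorphic in $\Omega$. A boundary for $\Omega$ is a subset of $\overline{\Omega}$ on which every function in $A(\Omega)$ attains its maximum modulus; the distinguished boundary $b\overline{\Omega}$ is the smallest closed boundary. It is known (Abouhajar, White and Young) that \[ b\overline{\mathbb{E}}=\{(x_1,x_2,x_3)\in\mathbb{C}^3 : |x_1|\le1,\ x_1=\overline{x}_2x_3,\ |x_3|=1\}. \] *)

theory Defs
  imports "HOL-Analysis.Analysis"
begin

abbreviation disc :: "complex set" where
  "disc \<equiv> ball 0 1"

text \<open>Maps are total functions on the type of complex numbers; only their values on the
  disc matter below.\<close>

definition Aut_disc :: "(complex \<Rightarrow> complex) set" where
  "Aut_disc = {f. bij_betw f disc disc \<and> f holomorphic_on disc \<and>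
     inv_into disc f holomorphic_on disc}"

definition blaschke :: "complex \<Rightarrow> complex \<Rightarrow> complex" where
  "blaschke \<alpha> z = (z - \<alpha>) / (cnj \<alpha> * z - 1)"

definition tetrablock :: "(complex^3) set" where
  "tetrablock = {vector [A $ 1 $ 1, A $ 2 $ 2, det A] | A :: complex^2^2. onorm ((*v) A) < 1}"

text \<open>Holomorphy in several variables: Frechet differentiability with a complex-linear derivative
  (\<open>*s\<close> is multiplication of a vector by a complex scalar).\<close>

definition holomorphic_several_on :: "(complex^'n \<Rightarrow> complex) \<Rightarrow> (complex^'n) set \<Rightarrow> bool" where
  "holomorphic_several_on f \<Omega> \<longleftrightarrow>
     (\<forall>x\<in>\<Omega>. \<exists>D. (f has_derivative D) (at x) \<and> (\<forall>c v. D (c *s v) = c * D v))"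

definition alg_A :: "(complex^'n) set \<Rightarrow> (complex^'n \<Rightarrow> complex) set" where
  "alg_A \<Omega> = {f. continuous_on (closure \<Omega>) f \<and> holomorphic_several_on f \<Omega>}"

definition is_boundary :: "(complex^'n) set \<Rightarrow> (complex^'n) set \<Rightarrow> bool" where
  "is_boundary \<Omega> B \<longleftrightarrow> B \<subseteq> closure \<Omega> \<and>
     (\<forall>f\<in>alg_A \<Omega>. \<exists>x\<in>B. \<forall>y\<in>closure \<Omega>. norm (f y) \<le> norm (f x))"

text \<open>\<open>LEAST\<close> refers to the inclusion order on sets.\<close>

definition distinguished_boundary :: "(complex^'n) set \<Rightarrow> (complex^'n) set" where
  "distinguished_boundary \<Omega> = (LEAST B. closed B \<and> is_boundary \<Omega> B)"

definition triangular_points :: "(complex^3) set" where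
  "triangular_points = {x \<in> closure tetrablock. x $ 1 * x $ 2 = x $ 3}"

definition T_formula ::
  "complex \<Rightarrow> complex \<Rightarrow> complex \<Rightarrow> complex \<Rightarrow> complex^3 \<Rightarrow> complex^3" where
  "T_formula \<xi>1 z1 \<xi>2 z2 x =
    (let x1 = x $ 1; x2 = x $ 2; x3 = x $ 3;
         d = (1 - cnj z1 * x1) - \<xi>2 * cnj z2 * (x2 - cnj z1 * x3)
     in vector
       [\<xi>1 * (((x1 - z1) + \<xi>2 * cnj z2 * (z1 * x2 - x3)) / d),
        (z2 * (cnj z1 * x1 - 1) + \<xi>2 * (x2 - cnj z1 * x3)) / d,
        \<xi>1 * ((z2 * (z1 - x1) - \<xi>2 * (z1 * x2 - x3)) / d)])"

text \<open>\<open>\<kappa>\<close> plays the role of the customary letter chi, which is taken by the vector binder.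
  The parameters are determined by \<open>v\<close> and \<open>\<kappa>\<close> (see \<open>T_aut_eq\<close> below), so the
  description picks out a unique value for all \<open>v\<close> and \<open>\<kappa>\<close> in \<open>Aut_disc\<close>.\<close>

definition T_aut ::
  "(complex \<Rightarrow> complex) \<Rightarrow> (complex \<Rightarrow> complex) \<Rightarrow> complex^3 \<Rightarrow> complex^3" where
  "T_aut v \<kappa> x = (THE y. \<exists>\<xi>1 z1 \<xi>2 z2.
     \<xi>1 \<in> sphere 0 1 \<and> \<xi>2 \<in> sphere 0 1 \<and> z1 \<in> disc \<and> z2 \<in> disc \<and>
     (\<forall>z\<in>disc. v z = - \<xi>1 * blaschke z1 z) \<and>
     (\<forall>z\<in>disc. \<kappa> z = - \<xi>2 * blaschke (- cnj z2) z) \<and>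
     y = T_formula \<xi>1 z1 \<xi>2 z2 x)"

lemma blaschke_params_unique:
  assumes "a \<in> disc" "b \<in> disc" "\<xi> \<in> sphere 0 1" "\<eta> \<in> sphere 0 1"
    and eq: "\<And>z. z \<in> disc \<Longrightarrow> - \<xi> * blaschke a z = - \<eta> * blaschke b z"
  shows "\<xi> = \<eta> \<and> a = b"
proof -
  have den: "cnj c * z - 1 \<noteq> 0" if "c \<in> disc" "z \<in> disc" for c z
  proof
    assume "cnj c * z - 1 = 0"
    then have "norm c * norm z = 1"
      by (metis complex_mod_cnj eq_iff_diff_eq_0 norm_mult norm_one)
    moreover have "norm c * norm z < 1 * 1"
      using that by (intro mult_strict_mono') auto
    ultimately show False by simp
  qed
  have nz: "\<xi> \<noteq> 0" "\<eta> \<noteq> 0"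
    using assms by auto
  have "blaschke b a = 0"
    using eq[OF assms(1)] nz by (simp add: blaschke_def)
  with den[OF assms(2,1)] have ab: "a = b"
    by (simp add: blaschke_def)
  have "\<exists>z\<in>disc. z \<noteq> a"
    by (rule bexI[of _ "if a = 0 then 1/2 else 0"]) auto
  then obtain z where z: "z \<in> disc" "z \<noteq> a"
    by blast
  then have "blaschke a z \<noteq> 0"
    using den[OF assms(1), of z] by (simp add: blaschke_def)
  with eq[OF z(1)] ab show ?thesis
    by simp
qed

lemma T_aut_eq:
  assumes "\<xi>1 \<in> sphere 0 1" "\<xi>2 \<in> sphere 0 1" "z1 \<in> disc" "z2 \<in> disc"
    and "\<And>z. z \<in> disc \<Longrightarrow> v z = - \<xi>1 * blaschke z1 z"
    and "\<And>z. z \<in> disc \<Longrightarrow> \<kappa> z = - \<xi>2 * blaschke (- cnj z2) z"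
  shows "T_aut v \<kappa> x = T_formula \<xi>1 z1 \<xi>2 z2 x"
  unfolding T_aut_def
proof (rule the_equality)
  show "\<exists>\<eta>1 w1 \<eta>2 w2.
     \<eta>1 \<in> sphere 0 1 \<and> \<eta>2 \<in> sphere 0 1 \<and> w1 \<in> disc \<and> w2 \<in> disc \<and>
     (\<forall>z\<in>disc. v z = - \<eta>1 * blaschke w1 z) \<and>
     (\<forall>z\<in>disc. \<kappa> z = - \<eta>2 * blaschke (- cnj w2) z) \<and>
     T_formula \<xi>1 z1 \<xi>2 z2 x = T_formula \<eta>1 w1 \<eta>2 w2 x"
    using assms by blast
next
  fix y
  assume "\<exists>\<eta>1 w1 \<eta>2 w2.
     \<eta>1 \<in> sphere 0 1 \<and> \<eta>2 \<in> sphere 0 1 \<and> w1 \<in> disc \<and> w2 \<in> disc \<and>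
     (\<forall>z\<in>disc. v z = - \<eta>1 * blaschke w1 z) \<and>
     (\<forall>z\<in>disc. \<kappa> z = - \<eta>2 * blaschke (- cnj w2) z) \<and>
     y = T_formula \<eta>1 w1 \<eta>2 w2 x"
  then obtain \<eta>1 w1 \<eta>2 w2 where
    h: "\<eta>1 \<in> sphere 0 1" "\<eta>2 \<in> sphere 0 1" "w1 \<in> disc" "w2 \<in> disc"
       "\<And>z. z \<in> disc \<Longrightarrow> v z = - \<eta>1 * blaschke w1 z"
       "\<And>z. z \<in> disc \<Longrightarrow> \<kappa> z = - \<eta>2 * blaschke (- cnj w2) z"
    and y: "y = T_formula \<eta>1 w1 \<eta>2 w2 x"
    by blast
  have "\<eta>1 = \<xi>1 \<and> w1 = z1"
    by (rule blaschke_params_unique) (use h assms in \<open>simp_all\<close>)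
  moreover have "\<eta>2 = \<xi>2 \<and> - cnj w2 = - cnj z2"
    by (rule blaschke_params_unique) (use h assms in \<open>simp_all\<close>)
  ultimately show "y = T_formula \<xi>1 z1 \<xi>2 z2 x"
    using y by simp
qed

end

theory Submission
  imports Defs "HOL-Complex_Analysis.Riemann_Mapping"
begin

text \<open>
  Each point \<open>x\<close> of the tetrablock lies on an affine analytic disc
  \<open>l \<mapsto> (p + cnj q * l, q + cnj p * l, l)\<close> with \<open>|p| + |q| < 1\<close>, which stays in the tetrablock
  for \<open>|l| < 1\<close> and whose boundary circle lies in
  \<open>K = {x. |x1| \<le> 1, x1 = cnj x2 * x3, |x3| = 1}\<close>; hence the maximum principle in one
  variable makes \<open>K\<close> a boundary. It is the smallest one because every \<open>p \<in> K\<close> is the unique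
  maximum point of a function of the algebra: \<open>1 + cnj p1 * x1 + cnj p2 * x2\<close> if \<open>|p1| = 1\<close>,
  and \<open>p3 + (1 - |p1|\<^sup>2) (x3 - x1 x2) / (1 - cnj p1 * x1)\<^sup>2\<close> if \<open>|p1| < 1\<close>.

  A point of \<open>K\<close> is triangular iff \<open>|x1| = 1\<close>. By the Schwarz lemma every automorphism of the disc
  is a rotated Blaschke factor, so the two orbits can be read off from the explicit formula.
\<close>

section \<open>The tetrablock as a semialgebraic set\<close>

text \<open>The last inequality says \<open>det (I - A^* A) > 0\<close> for the symmetric matrix
  \<open>A\<close> with diagonal entries \<open>a\<close>, \<open>b\<close> and determinant
  \<open>c\<close>. The bound on \<open>c\<close> rules out that both eigenvalues of
  \<open>I - A^* A\<close> are negative.\<close>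

definition tetrablock_ineq :: "complex \<Rightarrow> complex \<Rightarrow> complex \<Rightarrow> bool" where
  "tetrablock_ineq a b c \<longleftrightarrow> cmod a < 1 \<and> cmod b < 1 \<and> cmod c < 1 \<and>
     2 * cmod (a * b - c) < 1 - (cmod a)\<^sup>2 - (cmod b)\<^sup>2 + (cmod c)\<^sup>2"

text \<open>Both sides are \<open>det (I - A^* A)\<close> for the matrix with rows
  \<open>(a, b)\<close> and \<open>(c, d)\<close>: on the left from its entries, on the right as
  \<open>1 - tr (A^* A) + |det A|^2\<close>.\<close>

lemma gram_det:
  fixes a b c d :: complex
  shows "(1 - (cmod a)\<^sup>2 - (cmod c)\<^sup>2) * (1 - (cmod b)\<^sup>2 - (cmod d)\<^sup>2) - (cmod (cnj a * b + cnj c * d))\<^sup>2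
    = 1 - (cmod a)\<^sup>2 - (cmod b)\<^sup>2 - (cmod c)\<^sup>2 - (cmod d)\<^sup>2 + (cmod (a * d - b * c))\<^sup>2"
  unfolding cmod_power2 plus_complex.sel minus_complex.sel times_complex.sel cnj.sel by algebra

text \<open>This is the Hermitian form of \<open>I - A^* A\<close> at the vector
  \<open>(p, q)\<close>.\<close>

lemma gram_form:
  fixes a b c d p q :: complex
  shows "(cmod p)\<^sup>2 + (cmod q)\<^sup>2 - (cmod (a * p + b * q))\<^sup>2 - (cmod (c * p + d * q))\<^sup>2
    = (1 - (cmod a)\<^sup>2 - (cmod c)\<^sup>2) * (cmod p)\<^sup>2 + (1 - (cmod b)\<^sup>2 - (cmod d)\<^sup>2) * (cmod q)\<^sup>2
      - 2 * Re ((cnj a * b + cnj c * d) * cnj p * q)"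
  unfolding cmod_power2 plus_complex.sel minus_complex.sel times_complex.sel cnj.sel by algebra

text \<open>Positive definiteness of \<open>I - A^* A\<close> makes its diagonal entries and
  determinant positive. The off-diagonal entries of \<open>A\<close> enter only through
  \<open>2 |b c| \<le> |b|^2 + |c|^2\<close>, where \<open>b c\<close> is the diagonal product minus
  \<open>det A\<close>.\<close>

lemma contraction_imp_tetrablock_ineq:
  fixes a b c d :: complex
  assumes contr: "\<And>p q. p \<noteq> 0 \<or> q \<noteq> 0 \<Longrightarrow>
      (cmod (a * p + b * q))\<^sup>2 + (cmod (c * p + d * q))\<^sup>2 < (cmod p)\<^sup>2 + (cmod q)\<^sup>2"
  shows "tetrablock_ineq a d (a * d - b * c)"
proof -
  define h where "h = cnj a * b + cnj c * d"
  define H where "H = 1 - (cmod a)\<^sup>2 - (cmod c)\<^sup>2"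
  define G where "G = 1 - (cmod b)\<^sup>2 - (cmod d)\<^sup>2"
  have H: "H > 0" using contr[of 1 0] by (simp add: H_def)
  have G: "G > 0" using contr[of 0 1] by (simp add: G_def)
  \<comment> \<open>Testing on \<open>(h, H)\<close> yields \<open>H\<close> times the determinant of \<open>I - A^* A\<close>.\<close>
  have "(cmod h)\<^sup>2 + (cmod (of_real H))\<^sup>2 - (cmod (a * h + b * of_real H))\<^sup>2 - (cmod (c * h + d * of_real H))\<^sup>2 
     = H * (cmod h)\<^sup>2 + G * H\<^sup>2 - 2 * Re (h * cnj h * of_real H)"
    using gram_form[of h "of_real H" a b c d, folded H_def G_def h_def]
    unfolding norm_of_real power2_abs by simp
  moreover have "Re (h * cnj h * of_real H) = (cmod h)\<^sup>2 * H"
    by (simp add: complex_mult_cnj cmod_power2)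
  ultimately have "H * (cmod h)\<^sup>2 + G * H\<^sup>2 - 2 * ((cmod h)\<^sup>2 * H) > 0"
    using contr[of h "of_real H"] H by simp
  then have "H * (G * H - (cmod h)\<^sup>2) > 0"
    by (simp add: algebra_simps power2_eq_square)
  then have det: "H * G - (cmod h)\<^sup>2 > 0"
    using H by (simp add: zero_less_mult_iff mult.commute)
  have e: "H * G - (cmod h)\<^sup>2 = 1 - (cmod a)\<^sup>2 - (cmod b)\<^sup>2 - (cmod c)\<^sup>2 - (cmod d)\<^sup>2 + (cmod (a * d - b * c))\<^sup>2"
    unfolding H_def G_def h_def by (rule gram_det)
  have "2 * cmod (b * c) \<le> (cmod b)\<^sup>2 + (cmod c)\<^sup>2"
    using sum_squares_bound[of "cmod b" "cmod c"] by (simp add: norm_mult power2_eq_square)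
  with det e have 1: "2 * cmod (b * c) < 1 - (cmod a)\<^sup>2 - (cmod d)\<^sup>2 + (cmod (a * d - b * c))\<^sup>2"
    by linarith
  have "(cmod a)\<^sup>2 < 1" "(cmod d)\<^sup>2 < 1"
    using H G zero_le_power2[of "cmod c"] zero_le_power2[of "cmod b"] unfolding H_def G_def by linarith+
  then have 2: "cmod a < 1" "cmod d < 1"
    by (simp_all add: abs_square_less_1)
  have "(1 - H) * (1 - G) \<ge> 0" by (intro mult_nonneg_nonneg) (auto simp: H_def G_def)
  \<comment> \<open>Hence \<open>1 - |det A|^2 = H + G - (H * G - |h|^2)\<close>, which is positive
    as soon as \<open>H * G < H + G\<close>.\<close>
  moreover have "H + G = (H * G - (cmod h)\<^sup>2) + 1 - (cmod (a * d - b * c))\<^sup>2"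
    unfolding e by (simp add: H_def G_def)
  moreover have "H * G - (cmod h)\<^sup>2 \<le> H * G" by simp
  moreover have "H * G < H + G" 
  proof -
    have "H \<le> 1" by (simp add: H_def)
    then have "H * G \<le> 1 * G" using G by (intro mult_right_mono) auto
    with H show ?thesis by simp
  qed
  ultimately have "(cmod (a * d - b * c))\<^sup>2 < 1" by linarith
  then have 3: "cmod (a * d - b * c) < 1"  by (simp add: abs_square_less_1)
  show ?thesis using 1 2 3 by (simp add: tetrablock_ineq_def)
qed

text \<open>A symmetric matrix suffices: its off-diagonal entry is a square root of \<open>x1 x2 - x3\<close>.\<close>

lemma tetrablock_ineq_imp_contraction:
  fixes a d c b p q :: complex
  assumes "tetrablock_ineq a d c" "b\<^sup>2 = a * d - c" "p \<noteq> 0 \<or> q \<noteq> 0"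
  shows "(cmod (a * p + b * q))\<^sup>2 + (cmod (b * p + d * q))\<^sup>2 < (cmod p)\<^sup>2 + (cmod q)\<^sup>2"
proof -
  define h where "h = cnj a * b + cnj b * d"
  define H where "H = 1 - (cmod a)\<^sup>2 - (cmod b)\<^sup>2"
  define G where "G = 1 - (cmod b)\<^sup>2 - (cmod d)\<^sup>2"
  have b2: "(cmod b)\<^sup>2 = cmod (a * d - c)"
    using assms(2) by (metis norm_power)
  have c: "a * d - b * b = c" using assms(2) by (simp add: power2_eq_square)
  have e: "H * G - (cmod h)\<^sup>2 = 1 - (cmod a)\<^sup>2 - (cmod b)\<^sup>2 - (cmod b)\<^sup>2 - (cmod d)\<^sup>2 + (cmod c)\<^sup>2"
    unfolding H_def G_def h_def gram_det c ..
  have det: "H * G - (cmod h)\<^sup>2 > 0"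
    unfolding e b2 using assms(1) by (simp add: tetrablock_ineq_def)
  \<comment> \<open>The positive determinant only makes \<open>H\<close> and \<open>G\<close> agree
    in sign; the trace \<open>H + G\<close>, positive because \<open>|c| < 1\<close>, fixes that
    sign.\<close>
  have "(cmod c)\<^sup>2 < 1" using assms(1) by (simp add: tetrablock_ineq_def abs_square_less_1)
  then have "H + G > 0" using det unfolding e by (simp add: H_def G_def)
  moreover have "H * G > 0" using det by (smt (verit) zero_le_power2)
  ultimately have H: "H > 0" and G: "G > 0" by (auto simp: zero_less_mult_iff)
  define x y where "x = cmod p" and "y = cmod q"
  have "Re (h * cnj p * q) \<le> cmod h * x * y"
    unfolding x_def y_def by (metis complex_Re_le_cmod complex_mod_cnj norm_mult)
  moreover have "2 * (cmod h * x * y) < H * x\<^sup>2 + G * y\<^sup>2"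
  proof (cases "y = 0")
    case True
    then show ?thesis using assms(3) H by (simp add: x_def y_def)
  next
    case False
    \<comment> \<open>Completing the square writes \<open>H\<close> times the quadratic form as a
      square plus a positive term.\<close>
    have "0 \<le> (H * x - cmod h * y)\<^sup>2" by simp
    moreover have "(H * G - (cmod h)\<^sup>2) * y\<^sup>2 > 0" using det False by simp
    moreover have "(H * x - cmod h * y)\<^sup>2 + (H * G - (cmod h)\<^sup>2) * y\<^sup>2 = H * (H * x\<^sup>2 + G * y\<^sup>2 - 2 * (cmod h * x * y))"
      by (simp add: algebra_simps power2_eq_square)
    ultimately have "H * (H * x\<^sup>2 + G * y\<^sup>2 - 2 * (cmod h * x * y)) > 0" by linarith
    then show ?thesis using H by (simp add: zero_less_mult_iff)
  qed
  ultimately have "H * x\<^sup>2 + G * y\<^sup>2 - 2 * Re (h * cnj p * q) > 0" by linarith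
  then show ?thesis
    using gram_form[of p q a b b d] unfolding H_def G_def h_def x_def y_def by linarith
qed

section \<open>Strict contractions and the operator norm\<close>

lemma onorm_less_one_iff:
  fixes f :: "'a::euclidean_space \<Rightarrow> 'b::real_normed_vector"
  assumes "bounded_linear f"
  shows "onorm f < 1 \<longleftrightarrow> (\<forall>v. v \<noteq> 0 \<longrightarrow> norm (f v) < norm v)"
proof
  assume *: "onorm f < 1"
  show "\<forall>v. v \<noteq> 0 \<longrightarrow> norm (f v) < norm v"
  proof (intro allI impI)
    fix v :: 'a assume "v \<noteq> 0"
    have "norm (f v) \<le> onorm f * norm v" by (rule onorm[OF assms])
    also have "\<dots> < 1 * norm v" using * \<open>v \<noteq> 0\<close> by (intro mult_strict_right_mono) auto
    finally show "norm (f v) < norm v" by simp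
  qed
next
  assume *: "\<forall>v. v \<noteq> 0 \<longrightarrow> norm (f v) < norm v"
  interpret f: bounded_linear f by fact
  \<comment> \<open>Compactness of the unit sphere turns the pointwise strict inequality into a
    uniform one.\<close>
  have "continuous_on (sphere 0 1) (\<lambda>v. norm (f v))"
    by (intro continuous_intros f.continuous_on)
  moreover have "sphere (0::'a) 1 \<noteq> {}" by simp
  ultimately obtain u where u: "u \<in> sphere 0 1" "\<And>v. v \<in> sphere 0 1 \<Longrightarrow> norm (f v) \<le> norm (f u)"
    using continuous_attains_sup[OF compact_sphere] by metis
  have "norm (f v) \<le> norm (f u) * norm v" for v
  proof (cases "v = 0")
    case False
    have "norm (f (v /\<^sub>R norm v)) \<le> norm (f u)" using False by (intro u) simp
    then show ?thesis using False by (simp add: f.scaleR field_simps)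
  qed (simp add: f.zero)
  then have "onorm f \<le> norm (f u)" by (rule onorm_le)
  also have "\<dots> < 1" using *[rule_format, of u] u(1) by force
  finally show "onorm f < 1" .
qed

lemma norm_vec2_power2:
  fixes v :: "complex^2"
  shows "(norm v)\<^sup>2 = (cmod (v $ 1))\<^sup>2 + (cmod (v $ 2))\<^sup>2"
  by (simp add: norm_vec_def L2_set_def sum_2)

lemma contraction2_iff:
  fixes A :: "complex^2^2"
  shows "onorm ((*v) A) < 1 \<longleftrightarrow> (\<forall>p q. p \<noteq> 0 \<or> q \<noteq> 0 \<longrightarrow>
    (cmod (A$1$1 * p + A$1$2 * q))\<^sup>2 + (cmod (A$2$1 * p + A$2$2 * q))\<^sup>2 < (cmod p)\<^sup>2 + (cmod q)\<^sup>2)"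
proof -
  have "norm (A *v v) < norm v \<longleftrightarrow> (norm (A *v v))\<^sup>2 < (norm v)\<^sup>2" for v
    by (simp add: power2_less_imp_less power_strict_mono linorder_not_le abs_le_square_iff[symmetric] flip: not_le)
  then have "norm (A *v v) < norm v \<longleftrightarrow> (cmod (A$1$1 * v$1 + A$1$2 * v$2))\<^sup>2 + (cmod (A$2$1 * v$1 + A$2$2 * v$2))\<^sup>2 < (cmod (v$1))\<^sup>2 + (cmod (v$2))\<^sup>2" for v
    by (simp add: norm_vec2_power2 matrix_vector_mult_def sum_2)
  then show ?thesis
    unfolding onorm_less_one_iff[OF matrix_vector_mul_bounded_linear]
    by (simp add: forall_vector_2 vec_eq_iff forall_2)
qed

text \<open>From here on matrices disappear: the tetrablock is handled through these inequalities
  only.\<close>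

lemma tetrablock_iff: "x \<in> tetrablock \<longleftrightarrow> tetrablock_ineq (x$1) (x$2) (x$3)"
proof
  assume "x \<in> tetrablock"
  then obtain A :: "complex^2^2" where x: "x = vector [A $ 1 $ 1, A $ 2 $ 2, det A]" and A: "onorm ((*v) A) < 1"
    by (auto simp: tetrablock_def)
  show "tetrablock_ineq (x$1) (x$2) (x$3)"
    unfolding x vector_3 det_2
    by (rule contraction_imp_tetrablock_ineq) (use A contraction2_iff in blast)
next
  assume t: "tetrablock_ineq (x$1) (x$2) (x$3)"
  define b where "b = csqrt (x$1 * x$2 - x$3)"
  have b: "b\<^sup>2 = x$1 * x$2 - x$3" by (simp add: b_def)
  define A :: "complex^2^2" where "A = vector [vector [x$1, b], vector [b, x$2]]"
  have "onorm ((*v) A) < 1"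
    unfolding contraction2_iff using tetrablock_ineq_imp_contraction[OF t b] by (simp add: A_def)
  moreover have "x = vector [A $ 1 $ 1, A $ 2 $ 2, det A]"
    using b by (simp add: A_def vec_eq_iff forall_3 det_2 power2_eq_square)
  ultimately show "x \<in> tetrablock" by (auto simp: tetrablock_def)
qed

section \<open>Analytic discs and inequalities\<close>

text \<open>Both sides expand to the same expression, symmetric in the squared moduli apart from the
  term in \<open>Re (a * b * cnj c)\<close>. It trades a bound on \<open>a * b - c\<close> for one
  on \<open>a - cnj b * c\<close>.\<close>

lemma heron_identity:
  fixes a b c :: complex
  shows "(1 - (cmod a)\<^sup>2 - (cmod b)\<^sup>2 + (cmod c)\<^sup>2)\<^sup>2 - 4 * (cmod (a * b - c))\<^sup>2
    = (1 + (cmod a)\<^sup>2 - (cmod b)\<^sup>2 - (cmod c)\<^sup>2)\<^sup>2 - 4 * (cmod (a - cnj b * c))\<^sup>2"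
  unfolding cmod_power2 minus_complex.sel times_complex.sel cnj.sel by algebra

text \<open>If \<open>x + y \<ge> 1\<close>, replace \<open>z\<close> by the smaller
  \<open>x + y - 1\<close>; the remaining gap is \<open>2 (1 - x) (1 - y)\<close>.\<close>

lemma sum_squares_less:
  fixes x y z :: real
  assumes "0 \<le> x" "0 \<le> y" "x < 1" "y < 1" "x + y < 1 + z"
  shows "x\<^sup>2 + y\<^sup>2 < 1 + z\<^sup>2"
proof (cases "x + y < 1")
  case True
  have "x\<^sup>2 + y\<^sup>2 \<le> (x + y)\<^sup>2" using assms by (simp add: power2_sum)
  also have "\<dots> < 1" using True assms by (simp add: abs_square_less_1)
  finally show ?thesis by (smt (verit) zero_le_power2)
next
  case False
  then have "(x + y - 1)\<^sup>2 \<le> z\<^sup>2" using assms by (intro power_mono) auto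
  moreover have "(1 - x) * (1 - y) > 0" using assms by simp
  moreover have "1 + (x + y - 1)\<^sup>2 - x\<^sup>2 - y\<^sup>2 = 2 * ((1 - x) * (1 - y))"
    by (simp add: power2_eq_square algebra_simps)
  ultimately show ?thesis by linarith
qed

lemma tetrablock_ineq_commute: "tetrablock_ineq a b c \<longleftrightarrow> tetrablock_ineq b a c"
  by (auto simp: tetrablock_ineq_def mult.commute)

text \<open>The bound \<open>|a b - c| \<ge> |c| - |a| |b|\<close> gives
  \<open>(|b| - |a|)^2 < (1 - |c|)^2\<close>, hence \<open>|b| + |c| < 1 + |a|\<close>. The
  conclusion provides the signs needed later for taking square roots of inequalities.\<close>

lemma tetrablock_ineq_sum_squares:
  assumes "tetrablock_ineq a b c"
  shows "(cmod b)\<^sup>2 + (cmod c)\<^sup>2 < 1 + (cmod a)\<^sup>2"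
proof -
  have "cmod c - cmod a * cmod b \<le> cmod (a * b - c)"
    by (metis norm_minus_commute norm_mult norm_triangle_ineq2)
  then have "(cmod b - cmod a)\<^sup>2 < (1 - cmod c)\<^sup>2"
    using assms by (simp add: tetrablock_ineq_def power2_diff algebra_simps)
  then have "cmod b - cmod a < 1 - cmod c"
    by (rule power2_less_imp_less) (use assms in \<open>simp add: tetrablock_ineq_def\<close>)
  then show ?thesis
    using assms by (intro sum_squares_less) (auto simp: tetrablock_ineq_def)
qed

text \<open>The claim is a square root of
  \<open>(N - w)^2 - |b - cnj a * c|^2 = N (D - 2 w) > 0\<close>, taken once \<open>w < N\<close> is
  known. Its weak form holds on the closure and drives the equality cases of the peak
  functions.\<close>

lemma tetrablock_ineq_diag_bound:
  assumes "tetrablock_ineq a b c"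
  shows "cmod (b - cnj a * c) + cmod (a * b - c) < 1 - (cmod a)\<^sup>2"
proof -
  define N where "N = 1 - (cmod a)\<^sup>2"
  define D where "D = 1 - (cmod a)\<^sup>2 - (cmod b)\<^sup>2 + (cmod c)\<^sup>2"
  define w where "w = cmod (a * b - c)"
  have N: "N > 0" using assms by (simp add: N_def tetrablock_ineq_def abs_square_less_1)
  have w: "2 * w < D" using assms by (simp add: w_def D_def tetrablock_ineq_def)
  have "D < 2 * N"
    using tetrablock_ineq_sum_squares[of b a c] assms tetrablock_ineq_commute by (simp add: D_def N_def)
  with w have "w < N" by linarith
  have "(N - w)\<^sup>2 - (cmod (b - cnj a * c))\<^sup>2 = N * (D - 2 * w)"
  proof -
    have "w\<^sup>2 - (cmod (b - cnj a * c))\<^sup>2 = N * ((cmod c)\<^sup>2 - (cmod b)\<^sup>2)"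
      unfolding w_def N_def cmod_power2 minus_complex.sel times_complex.sel cnj.sel by algebra
    then show ?thesis by (simp add: D_def N_def power2_eq_square algebra_simps)
  qed
  moreover have "N * (D - 2 * w) > 0" using N w by simp
  ultimately have "(cmod (b - cnj a * c))\<^sup>2 < (N - w)\<^sup>2" by linarith
  then have "cmod (b - cnj a * c) < N - w"
    by (rule power2_less_imp_less) (use \<open>w < N\<close> in simp)
  then show ?thesis by (simp add: N_def w_def)
qed

text \<open>Divided by \<open>1 - |c|^2\<close>, this is the condition \<open>|p| + |q| < 1\<close>
  on the parameters of the disc through \<open>(a, b, c)\<close>. The identity above gives
  \<open>2 P < S\<close>, and the factorization with \<open>M\<close> then works as in the previous
  lemma.\<close>

lemma tetrablock_ineq_beta_bound:
  assumes "tetrablock_ineq a b c"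
  shows "cmod (a - cnj b * c) + cmod (b - cnj a * c) < 1 - (cmod c)\<^sup>2"
proof -
  define M where "M = 1 - (cmod c)\<^sup>2"
  define D where "D = 1 - (cmod a)\<^sup>2 - (cmod b)\<^sup>2 + (cmod c)\<^sup>2"
  define S where "S = 1 + (cmod a)\<^sup>2 - (cmod b)\<^sup>2 - (cmod c)\<^sup>2"
  define P where "P = cmod (a - cnj b * c)"
  have M: "M > 0" using assms by (simp add: M_def tetrablock_ineq_def abs_square_less_1)
  have S: "S > 0" "S < 2 * M"
    using tetrablock_ineq_sum_squares[of a b c] tetrablock_ineq_sum_squares[of b a c] assms tetrablock_ineq_commute
    by (auto simp: S_def M_def)
  have "(2 * cmod (a * b - c))\<^sup>2 < D\<^sup>2"
    using assms by (intro power_strict_mono) (auto simp: D_def tetrablock_ineq_def)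
  then have "(2 * P)\<^sup>2 < S\<^sup>2"
    using heron_identity[of a b c] by (simp add: D_def S_def P_def power_mult_distrib)
  then have P: "2 * P < S"
    by (rule power2_less_imp_less) (use S in simp)
  have "(M - P)\<^sup>2 - (cmod (b - cnj a * c))\<^sup>2 = M * (S - 2 * P)"
  proof -
    have "P\<^sup>2 - (cmod (b - cnj a * c))\<^sup>2 = M * ((cmod a)\<^sup>2 - (cmod b)\<^sup>2)"
      unfolding P_def M_def cmod_power2 minus_complex.sel times_complex.sel cnj.sel by algebra
    then show ?thesis by (simp add: S_def M_def power2_eq_square algebra_simps)
  qed
  moreover have "M * (S - 2 * P) > 0" using M P by simp
  ultimately have "(cmod (b - cnj a * c))\<^sup>2 < (M - P)\<^sup>2" by linarith
  then have "cmod (b - cnj a * c) < M - P"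
    by (rule power2_less_imp_less) (use P S in simp)
  then show ?thesis by (simp add: M_def P_def)
qed

text \<open>The argument of the previous lemma is run backwards: \<open>p\<close> and
  \<open>q\<close> determine the conjugate combinations, and the Heron-type identity returns to
  \<open>a * b - l\<close>.\<close>

lemma beta_disc_tetrablock_ineq:
  assumes pq: "cmod p + cmod q < 1" and l: "cmod l < 1"
  shows "tetrablock_ineq (p + cnj q * l) (q + cnj p * l) l"
proof -
  define a b where "a = p + cnj q * l" and "b = q + cnj p * l"
  define x y t where "x = cmod p" and "y = cmod q" and "t = cmod l"
  have nn: "0 \<le> x" "0 \<le> y" "0 \<le> t" by (simp_all add: x_def y_def t_def)
  have xy: "x + y < 1" and t: "t < 1" using assms by (simp_all add: x_def y_def t_def)
  define M where "M = 1 - t\<^sup>2"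
  have M: "M > 0" using t nn by (simp add: M_def abs_square_less_1)
  have a: "cmod a \<le> x + y * t" and b: "cmod b \<le> y + x * t"
    unfolding a_def b_def x_def y_def t_def by (metis complex_mod_cnj norm_mult norm_triangle_ineq)+
  have "y * t \<le> y" "x * t \<le> x" using nn t by (auto intro: mult_left_le)
  with a b xy have a1: "cmod a < 1" and b1: "cmod b < 1" by linarith+
  define D where "D = 1 - (cmod a)\<^sup>2 - (cmod b)\<^sup>2 + (cmod l)\<^sup>2"
  define S where "S = 1 + (cmod a)\<^sup>2 - (cmod b)\<^sup>2 - (cmod l)\<^sup>2"
  \<comment> \<open>The identity only compares squares, so the sign of \<open>D\<close> has to be
    secured separately.\<close>
  have "D > 0"
  proof -
    have "(cmod a)\<^sup>2 + (cmod b)\<^sup>2 \<le> (x + y * t)\<^sup>2 + (y + x * t)\<^sup>2"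
      using a b by (intro add_mono power_mono) auto
    also have "\<dots> = (x + y)\<^sup>2 * (1 + t\<^sup>2) - 2 * x * y * (1 - t)\<^sup>2"
      by (simp add: power2_eq_square algebra_simps)
    also have "\<dots> \<le> (x + y)\<^sup>2 * (1 + t\<^sup>2)" using nn by simp
    also have "\<dots> < 1 * (1 + t\<^sup>2)"
      using xy nn by (intro mult_strict_right_mono) (auto simp: abs_square_less_1 add_pos_nonneg)
    finally show ?thesis by (simp add: D_def t_def)
  qed
  have ll: "l * cnj l = of_real (t\<^sup>2)" unfolding t_def complex_norm_square ..
  \<comment> \<open>These combinations cancel the conjugated parameters and leave \<open>p\<close>
    and \<open>q\<close> scaled by \<open>M\<close>.\<close>
  have "a - cnj b * l = p - p * (l * cnj l)" "b - cnj a * l = q - q * (l * cnj l)"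
    by (simp_all add: a_def b_def algebra_simps)
  then have ab: "a - cnj b * l = of_real M * p" "b - cnj a * l = of_real M * q"
    unfolding ll by (simp_all add: M_def algebra_simps)
  then have P: "cmod (a - cnj b * l) = M * x" and Q: "cmod (b - cnj a * l) = M * y"
    using M by (simp_all add: norm_mult x_def y_def del: of_real_diff)
  have "(cmod (a - cnj b * l))\<^sup>2 - (cmod (b - cnj a * l))\<^sup>2 = (1 - (cmod l)\<^sup>2) * ((cmod a)\<^sup>2 - (cmod b)\<^sup>2)"
    unfolding cmod_power2 minus_complex.sel times_complex.sel cnj.sel by algebra
  then have "M * (M * (x\<^sup>2 - y\<^sup>2)) = M * ((cmod a)\<^sup>2 - (cmod b)\<^sup>2)"
    unfolding P Q by (simp add: M_def t_def power2_eq_square algebra_simps)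
  then have "(cmod a)\<^sup>2 - (cmod b)\<^sup>2 = M * (x\<^sup>2 - y\<^sup>2)" using M by simp
  then have "S = M + M * (x\<^sup>2 - y\<^sup>2)" by (simp add: S_def M_def t_def)
  then have "S - 2 * (M * x) = M * ((1 - x)\<^sup>2 - y\<^sup>2)"
    by (simp add: power2_eq_square algebra_simps)
  moreover have "y\<^sup>2 < (1 - x)\<^sup>2" using nn xy by (intro power_strict_mono) auto
  ultimately have "2 * (M * x) < S" using M by (smt (verit) mult_pos_pos)
  then have "(2 * (M * x))\<^sup>2 < S\<^sup>2" using M nn by (intro power_strict_mono) auto
  then have "(2 * cmod (a * b - l))\<^sup>2 < D\<^sup>2"
    using heron_identity[of a b l] unfolding D_def[symmetric] S_def[symmetric] P
    by (simp add: power_mult_distrib)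
  then have "2 * cmod (a * b - l) < D"
    by (rule power2_less_imp_less) (use \<open>D > 0\<close> in simp)
  then show ?thesis
    using a1 b1 l unfolding tetrablock_ineq_def D_def a_def b_def by simp
qed

section \<open>The Shilov boundary\<close>

text \<open>Each bound holds strictly on the tetrablock, and its weak form is a closed
  condition.\<close>

lemma closure_tetrablock_bounds:
  assumes "x \<in> closure tetrablock"
  shows "cmod (x$1) \<le> 1" "cmod (x$2) \<le> 1" "cmod (x$3) \<le> 1"
    "cmod (x$2 - cnj (x$1) * x$3) + cmod (x$1 * x$2 - x$3) \<le> 1 - (cmod (x$1))\<^sup>2"
proof -
  define C where "C = {x::complex^3. cmod (x$1) \<le> 1} \<inter> {x. cmod (x$2) \<le> 1} \<inter> {x. cmod (x$3) \<le> 1} \<inter>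
    {x. cmod (x$2 - cnj (x$1) * x$3) + cmod (x$1 * x$2 - x$3) \<le> 1 - (cmod (x$1))\<^sup>2}"
  have "closed C"
    unfolding C_def by (intro closed_Int closed_Collect_le continuous_intros)
  moreover have "tetrablock \<subseteq> C"
  proof
    fix y assume "y \<in> tetrablock"
    then have "tetrablock_ineq (y$1) (y$2) (y$3)" by (simp add: tetrablock_iff)
    then show "y \<in> C"
      using tetrablock_ineq_diag_bound[of "y$1" "y$2" "y$3"] unfolding C_def by (simp add: tetrablock_ineq_def)
  qed
  ultimately have "closure tetrablock \<subseteq> C" by (rule closure_minimal[rotated])
  with assms show "cmod (x$1) \<le> 1" "cmod (x$2) \<le> 1" "cmod (x$3) \<le> 1"
    "cmod (x$2 - cnj (x$1) * x$3) + cmod (x$1 * x$2 - x$3) \<le> 1 - (cmod (x$1))\<^sup>2"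
    by (auto simp: C_def)
qed

lemma compact_closure_tetrablock: "compact (closure tetrablock)"
proof -
  have "norm x \<le> 3" if "x \<in> closure tetrablock" for x
  proof -
    have "norm x \<le> sum (\<lambda>i. norm (x $ i)) UNIV" by (simp add: norm_vec_def L2_set_le_sum)
    then show ?thesis using closure_tetrablock_bounds(1-3)[OF that] by (simp add: sum_3)
  qed
  then show ?thesis
    unfolding compact_eq_bounded_closed by (auto simp: bounded_iff)
qed

section \<open>Affine analytic discs and the set \<open>K\<close>\<close>

lemma bounded_linear_vector_scalar_mult:
  fixes w :: "complex^'n"
  shows "bounded_linear (\<lambda>l. l *s w)"
  unfolding linear_conv_bounded_linear[symmetric]
  by (rule linearI) (simp_all add: vec_eq_iff algebra_simps)

text \<open>Written as base point plus \<open>l *s\<close> direction, so that a complex-linear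
  derivative can be applied to the direction.\<close>

definition beta_disc :: "complex \<Rightarrow> complex \<Rightarrow> complex \<Rightarrow> complex^3" where
  "beta_disc p q l = vector [p, q, 0] + l *s vector [cnj q, cnj p, 1]"

lemma beta_disc_nth [simp]:
  "beta_disc p q l $ 1 = p + cnj q * l" "beta_disc p q l $ 2 = q + cnj p * l" "beta_disc p q l $ 3 = l"
  by (simp_all add: beta_disc_def)

lemma continuous_on_beta_disc: "continuous_on S (beta_disc p q)"
  unfolding beta_disc_def
  by (intro continuous_intros linear_continuous_on bounded_linear_vector_scalar_mult)

lemma beta_disc_in_tetrablock:
  assumes "cmod p + cmod q < 1" "cmod l < 1"
  shows "beta_disc p q l \<in> tetrablock"
  using beta_disc_tetrablock_ineq[OF assms] by (simp add: tetrablock_iff)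

lemma beta_disc_in_closure:
  assumes "cmod p + cmod q < 1" "cmod l \<le> 1"
  shows "beta_disc p q l \<in> closure tetrablock"
proof -
  have "beta_disc p q ` closure disc \<subseteq> closure tetrablock"
    using beta_disc_in_tetrablock[OF assms(1)]
    by (intro image_closure_subset continuous_on_beta_disc)
       (auto intro!: closure_subset[THEN subsetD])
  then show ?thesis using assms(2) by auto
qed

text \<open>The set \<open>K\<close> of the introduction, identified with the distinguished boundary
  in \<open>distinguished_boundary_tetrablock\<close>.\<close>

definition shilov :: "(complex^3) set" where
  "shilov = {x. cmod (x$1) \<le> 1 \<and> x$1 = cnj (x$2) * x$3 \<and> cmod (x$3) = 1}"

lemma unimodular_cnj: "cmod z = 1 \<Longrightarrow> z * cnj z = 1"
  by (metis complex_norm_square of_real_1 one_power2)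

lemma shilovD:
  assumes "x \<in> shilov"
  shows "x$2 = cnj (x$1) * x$3" "cmod (x$2) = cmod (x$1)"
proof -
  have "cnj (x$1) * x$3 = x$2 * (x$3 * cnj (x$3))"
    using assms by (simp add: shilov_def mult_ac)
  then show "x$2 = cnj (x$1) * x$3"
    using assms unimodular_cnj[of "x$3"] by (auto simp: shilov_def mult.commute)
  then show "cmod (x$2) = cmod (x$1)"
    using assms by (simp add: shilov_def norm_mult)
qed

text \<open>For \<open>t < 1\<close> the point \<open>(t y1, t y2, y3)\<close> lies on the disc with
  parameters \<open>t y1 / 2\<close> and \<open>t y2 / 2\<close> at \<open>l = y3\<close>: the
  relations defining \<open>K\<close> make both summands of each of the first two coordinates equal.
  Then \<open>t\<close> tends to 1.\<close>

lemma shilov_subset: "shilov \<subseteq> closure tetrablock"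
proof
  fix y assume y: "y \<in> shilov"
  note y2 = shilovD[OF y]
  define g :: "real \<Rightarrow> complex^3"
    where "g t = vector [0, 0, y$3] + t *\<^sub>R vector [y$1, y$2, 0]" for t
  have "g t \<in> closure tetrablock" if t: "t \<in> {0..<1}" for t
  proof -
    have "cmod (y$1) * t \<le> 1 * t" using y t by (intro mult_right_mono) (auto simp: shilov_def)
    then have "cmod (y$1) * t < 1" using t by simp
    then have "beta_disc (of_real (t/2) * y$1) (of_real (t/2) * y$2) (y$3) \<in> closure tetrablock"
      using y y2 t by (intro beta_disc_in_closure) (auto simp: shilov_def norm_mult mult.commute)
    moreover have "beta_disc (of_real (t/2) * y$1) (of_real (t/2) * y$2) (y$3) = g t"
    proof -
      have "of_real (t/2) * z + cnj (of_real (t/2) * w) * c = of_real t * z" if "z = cnj w * c" for z w c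
        unfolding that by (simp add: field_simps)
      note this[of "y$1" "y$2" "y$3"] this[of "y$2" "y$1" "y$3"]
      moreover have "g t $ 1 = of_real t * y$1" "g t $ 2 = of_real t * y$2" "g t $ 3 = y$3"
        unfolding g_def vector_add_component vector_scaleR_component vector_3
        unfolding scaleR_conv_of_real by simp_all
      ultimately show ?thesis
        using y y2(1) unfolding vec_eq_iff forall_3 shilov_def beta_disc_nth by simp
    qed
    ultimately show ?thesis by simp
  qed
  moreover have "continuous_on (closure {0..<1}) g"
    unfolding g_def by (intro continuous_intros)
  ultimately have "g ` closure {0..<1} \<subseteq> closure tetrablock"
    by (intro image_closure_subset) auto
  moreover have "g 1 = y" by (simp add: g_def vec_eq_iff forall_3)
  moreover have "1 \<in> closure {0..<1::real}" by simp
  ultimately show "y \<in> closure tetrablock" by blast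
qed

lemma closed_shilov: "closed shilov"
proof -
  have "shilov = {x. cmod (x$1) \<le> 1} \<inter> {x. x$1 = cnj (x$2) * x$3} \<inter> {x. cmod (x$3) = 1}"
    by (auto simp: shilov_def)
  also have "closed \<dots>"
    by (intro closed_Int closed_Collect_le closed_Collect_eq continuous_intros)
  finally show ?thesis .
qed

lemma beta_disc_in_shilov:
  assumes "cmod p + cmod q \<le> 1" "cmod l = 1"
  shows "beta_disc p q l \<in> shilov"
proof -
  have "cmod (p + cnj q * l) \<le> cmod p + cmod q * cmod l"
    by (metis complex_mod_cnj norm_mult norm_triangle_ineq)
  then show ?thesis
    using assms unimodular_cnj[OF assms(2)] by (simp add: shilov_def algebra_simps)
qed

text \<open>Eliminating \<open>q\<close> from the equations for \<open>y1\<close> and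
  \<open>y2\<close> gives \<open>y1 - cnj y2 * y3 = (1 - |y3|^2) p\<close>, and symmetrically for
  \<open>q\<close>.\<close>

lemma tetrablock_in_beta_disc:
  assumes "y \<in> tetrablock"
  obtains p q where "cmod p + cmod q < 1" "y = beta_disc p q (y$3)"
proof -
  define M where "M = 1 - (cmod (y$3))\<^sup>2"
  have t: "tetrablock_ineq (y$1) (y$2) (y$3)" using assms by (simp add: tetrablock_iff)
  then have M: "M > 0" by (simp add: M_def tetrablock_ineq_def abs_square_less_1)
  have MM: "complex_of_real M = 1 - y$3 * cnj (y$3)" 
    by (simp add: M_def flip: complex_norm_square)
  define p where "p = (y$1 - cnj (y$2) * y$3) / of_real M"
  define q where "q = (y$2 - cnj (y$1) * y$3) / of_real M"
  show thesis
  proof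
    show "cmod p + cmod q < 1"
      using tetrablock_ineq_beta_bound[OF t] M unfolding M_def[symmetric]
      by (simp add: p_def q_def norm_divide flip: add_divide_distrib)
    have "a = (a - cnj b * y$3) / of_real M + cnj ((b - cnj a * y$3) / of_real M) * y$3" for a b
    proof -
      have "(a - cnj b * y$3) + cnj (b - cnj a * y$3) * y$3 = a * of_real M"
        unfolding MM by (simp add: algebra_simps)
      then show ?thesis using M by (simp add: field_simps)
    qed
    then show "y = beta_disc p q (y$3)"
      by (simp add: vec_eq_iff forall_3 p_def q_def)
  qed
qed

text \<open>The maximum over the compact set \<open>K\<close> dominates \<open>f\<close> along the
  disc through each interior point; continuity carries the bound to the closure.\<close>

lemma is_boundary_shilov: "is_boundary tetrablock shilov"
  unfolding is_boundary_def
proof (intro conjI ballI shilov_subset)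
  fix f assume f: "f \<in> alg_A tetrablock"
  then have cont: "continuous_on (closure tetrablock) f" and hol: "holomorphic_several_on f tetrablock"
    by (auto simp: alg_A_def)
  have "compact shilov"
    using closed_Int_compact[OF closed_shilov compact_closure_tetrablock] shilov_subset
    by (simp add: Int_absorb2)
  moreover have "vector [1, 1, 1] \<in> shilov" by (simp add: shilov_def)
  moreover have "continuous_on shilov (\<lambda>x. norm (f x))"
    using continuous_on_subset[OF cont shilov_subset] by (intro continuous_intros)
  ultimately obtain x where x: "x \<in> shilov" "\<And>y. y \<in> shilov \<Longrightarrow> norm (f y) \<le> norm (f x)"
    using continuous_attains_sup[of shilov "\<lambda>x. norm (f x)"] by blast
  have "norm (f y) \<le> norm (f x)" if y: "y \<in> tetrablock" for y
  proof -
    obtain p q where pq: "cmod p + cmod q < 1" and yeq: "y = beta_disc p q (y$3)"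
      using tetrablock_in_beta_disc[OF y] .
    have "norm ((f \<circ> beta_disc p q) (y$3)) \<le> norm (f x)"
    proof (rule maximum_modulus_frontier[where f = "f \<circ> beta_disc p q" and S = disc])
      show "f \<circ> beta_disc p q holomorphic_on interior disc"
        unfolding holomorphic_on_def
      proof (intro ballI)
        fix l assume "l \<in> interior disc"
        then have "beta_disc p q l \<in> tetrablock"
          using pq by (intro beta_disc_in_tetrablock) auto
        then obtain D where D: "(f has_derivative D) (at (beta_disc p q l))" "\<And>c v. D (c *s v) = c * D v"
          using hol unfolding holomorphic_several_on_def by blast
        have "(beta_disc p q has_derivative (\<lambda>h. 0 + h *s vector [cnj q, cnj p, 1])) (at l)"
          unfolding beta_disc_def
          by (intro derivative_intros bounded_linear_imp_has_derivative bounded_linear_vector_scalar_mult)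
        \<comment> \<open>Complex linearity of \<open>D\<close> makes the derivative of the
          composition multiplication by one complex number, which is holomorphy in
          \<open>l\<close>.\<close>
        from diff_chain_at[OF this D(1)]
        have "(f \<circ> beta_disc p q has_derivative (\<lambda>h. D (vector [cnj q, cnj p, 1]) * h)) (at l)"
          by (simp add: o_def D(2) mult.commute)
        then show "f \<circ> beta_disc p q field_differentiable at l within interior disc"
          by (meson field_differentiable_at_within field_differentiable_def has_field_derivative_def)
      qed
      show "continuous_on (closure disc) (f \<circ> beta_disc p q)"
        using beta_disc_in_closure[OF pq]
        by (intro continuous_on_compose continuous_on_beta_disc continuous_on_subset[OF cont]) auto
      show "norm ((f \<circ> beta_disc p q) z) \<le> norm (f x)" if "z \<in> frontier disc" for z
        using that pq by (auto intro!: x beta_disc_in_shilov)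
      show "y$3 \<in> disc" using y by (simp add: tetrablock_iff tetrablock_ineq_def)
    qed simp
    then show ?thesis using yeq by simp
  qed
  then show "\<exists>x\<in>shilov. \<forall>y\<in>closure tetrablock. norm (f y) \<le> norm (f x)"
    using x(1) continuous_on_closure_norm_le[OF cont] by blast
qed

section \<open>Peak functions\<close>

lemma holomorphic_several_on_const: "holomorphic_several_on (\<lambda>x. c) S"
  unfolding holomorphic_several_on_def by (auto intro!: exI[of _ "\<lambda>x. 0"])

lemma holomorphic_several_on_nth: "holomorphic_several_on (\<lambda>x. x $ i) S"
  unfolding holomorphic_several_on_def
  by (auto intro!: exI[of _ "\<lambda>x. x $ i"] bounded_linear_imp_has_derivative)

lemma holomorphic_several_on_add:
  assumes "holomorphic_several_on f S" "holomorphic_several_on g S"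
  shows "holomorphic_several_on (\<lambda>x. f x + g x) S"
  unfolding holomorphic_several_on_def
proof
  fix x assume "x \<in> S"
  then obtain D E where "(f has_derivative D) (at x)" "\<And>c v. D (c *s v) = c * D v"
    "(g has_derivative E) (at x)" "\<And>c v. E (c *s v) = c * E v"
    using assms unfolding holomorphic_several_on_def by meson
  then show "\<exists>D. ((\<lambda>x. f x + g x) has_derivative D) (at x) \<and> (\<forall>c v. D (c *s v) = c * D v)"
    by (intro exI[of _ "\<lambda>h. D h + E h"] conjI has_derivative_add) (auto simp: algebra_simps)
qed

lemma holomorphic_several_on_mult:
  assumes "holomorphic_several_on f S" "holomorphic_several_on g S"
  shows "holomorphic_several_on (\<lambda>x. f x * g x) S"
  unfolding holomorphic_several_on_def
proof
  fix x assume "x \<in> S"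
  then obtain D E where "(f has_derivative D) (at x)" "\<And>c v. D (c *s v) = c * D v"
    "(g has_derivative E) (at x)" "\<And>c v. E (c *s v) = c * E v"
    using assms unfolding holomorphic_several_on_def by meson
  then show "\<exists>D. ((\<lambda>x. f x * g x) has_derivative D) (at x) \<and> (\<forall>c v. D (c *s v) = c * D v)"
    by (intro exI[of _ "\<lambda>h. f x * E h + D h * g x"] conjI has_derivative_mult)
      (auto simp: algebra_simps)
qed

lemma holomorphic_several_on_inverse:
  assumes "holomorphic_several_on f S" "\<And>x. x \<in> S \<Longrightarrow> f x \<noteq> 0"
  shows "holomorphic_several_on (\<lambda>x. inverse (f x)) S"
  unfolding holomorphic_several_on_def
proof
  fix x assume "x \<in> S"
  then obtain D where "(f has_derivative D) (at x)" "\<And>c v. D (c *s v) = c * D v" "f x \<noteq> 0"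
    using assms unfolding holomorphic_several_on_def by meson
  then show "\<exists>D. ((\<lambda>x. inverse (f x)) has_derivative D) (at x) \<and> (\<forall>c v. D (c *s v) = c * D v)"
    by (intro exI[of _ "\<lambda>h. - (inverse (f x) * D h * inverse (f x))"] conjI Deriv.has_derivative_inverse)
      (auto simp: algebra_simps)
qed

text \<open>Strict convexity of the disc, by the parallelogram law.\<close>

lemma unit_disc_extreme:
  fixes c u :: complex
  assumes "cmod c = 1" "cmod u \<le> 1" "2 \<le> cmod (c + u)"
  shows "u = c"
proof -
  have "(cmod (c + u))\<^sup>2 + (cmod (c - u))\<^sup>2 = 2 * (cmod c)\<^sup>2 + 2 * (cmod u)\<^sup>2"
    unfolding cmod_power2 by (simp add: power2_eq_square algebra_simps)
  moreover have "4 \<le> (cmod (c + u))\<^sup>2" using power_mono[of 2 "cmod (c + u)" 2] assms by simp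
  moreover have "(cmod u)\<^sup>2 \<le> 1" using assms by (simp add: power_le_one)
  ultimately have "(cmod (c - u))\<^sup>2 \<le> 0" unfolding assms(1) power_one by linarith
  then show ?thesis by simp
qed

lemma unit_disc_extreme3:
  fixes u v :: complex
  assumes "cmod u \<le> 1" "cmod v \<le> 1" "3 \<le> cmod (1 + u + v)"
  shows "u = 1" "v = 1"
proof -
  have "cmod (1 + u + v) \<le> cmod (1 + u) + cmod v" "cmod (1 + u + v) \<le> cmod (1 + v) + cmod u"
    by (metis norm_triangle_ineq add.assoc add.commute)+
  then show "u = 1" "v = 1"
    using assms by (auto intro!: unit_disc_extreme)
qed

text \<open>On the closure the summand \<open>u\<close> satisfies
  \<open>|u x| \<le> k (1 - |x1|^2) / |1 - cnj a * x1|^2 \<le> 1\<close>. So \<open>|f|\<close>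
  reaches 2 only where \<open>u = p3\<close>, and equality throughout determines the point; a
  maximum point in \<open>B\<close> must then be \<open>p\<close>.\<close>

lemma nontriangular_mem_boundary:
  assumes p: "p \<in> shilov" and lt: "cmod (p$1) < 1" and B: "is_boundary tetrablock B"
  shows "p \<in> B"
proof -
  define a where "a = p$1"
  define k where "k = 1 - (cmod a)\<^sup>2"
  have k: "k > 0" using lt by (simp add: k_def a_def abs_square_less_1)
  have p2: "p$2 = cnj a * p$3" and p3: "cmod (p$3) = 1"
    using p shilovD[OF p] by (auto simp: shilov_def a_def)
  define d where "d x = 1 - cnj a * x$1" for x :: "complex^3"
  define u where "u x = of_real k * (x$3 - x$1 * x$2) * (inverse (d x) * inverse (d x))" for x :: "complex^3"
  define f where "f x = p$3 + u x" for x
  \<comment> \<open>The pole stays off the closure because \<open>|a| < 1\<close>.\<close>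
  have d0: "d x \<noteq> 0" if "x \<in> closure tetrablock" for x
  proof -
    have "cmod (cnj a * x$1) \<le> cmod a * 1"
      unfolding norm_mult complex_mod_cnj using closure_tetrablock_bounds(1)[OF that] by (intro mult_left_mono) auto
    then have "cmod (cnj a * x$1) < 1" using lt by (simp add: a_def)
    then show ?thesis by (auto simp: d_def)
  qed
  have d_eq: "d = (\<lambda>x. 1 + (- cnj a) * x$1)"
    by (auto simp: d_def)
  have u_eq: "u = (\<lambda>x. of_real k * (x$3 + (-1) * (x$1 * x$2)) * (inverse (d x) * inverse (d x)))"
    by (auto simp: u_def)
  have "holomorphic_several_on d tetrablock"
    unfolding d_eq
    by (intro holomorphic_several_on_add holomorphic_several_on_mult holomorphic_several_on_const
        holomorphic_several_on_nth)
  then have "holomorphic_several_on f tetrablock"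
    unfolding f_def u_eq
    by (intro holomorphic_several_on_add holomorphic_several_on_mult holomorphic_several_on_const
        holomorphic_several_on_nth holomorphic_several_on_inverse)
      (use d0 closure_subset in blast)+
  moreover have "continuous_on (closure tetrablock) f"
    unfolding f_def u_def using d0 unfolding d_def by (intro continuous_intros) auto
  ultimately have "f \<in> alg_A tetrablock" by (simp add: alg_A_def)
  then obtain x where x: "x \<in> B" "\<And>y. y \<in> closure tetrablock \<Longrightarrow> cmod (f y) \<le> cmod (f x)"
    using B unfolding is_boundary_def by blast
  have xc: "x \<in> closure tetrablock" using B x(1) by (auto simp: is_boundary_def)
  note bounds = closure_tetrablock_bounds[OF xc]
  have "f p = 2 * p$3"
  proof -
    have "d p = of_real k" by (simp add: d_def k_def a_def complex_norm_square mult.commute flip: of_real_power)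
    moreover have "p$3 - p$1 * p$2 = of_real k * p$3"
      by (simp add: p2 k_def complex_norm_square algebra_simps flip: a_def of_real_power)
    ultimately have "u p = of_real k * (of_real k * p$3) * (inverse (of_real k) * inverse (of_real k))"
      by (simp only: u_def)
    then show ?thesis using k by (simp add: f_def field_simps)
  qed
  then have ge: "2 \<le> cmod (p$3 + u x)"
    using x(2)[of p] shilov_subset p p3 unfolding \<open>f p = 2 * p$3\<close> by (auto simp: f_def norm_mult)
  have nu: "cmod (u x) = k * cmod (x$1 * x$2 - x$3) / (cmod (d x))\<^sup>2"
    using k by (simp add: u_def norm_mult norm_inverse norm_minus_commute power2_eq_square divide_inverse)
  \<comment> \<open>The identity behind the pseudohyperbolic distance; its right-hand side measures
    how far \<open>x1\<close> is from \<open>a\<close>.\<close>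
  have id: "(cmod (d x))\<^sup>2 - k * (1 - (cmod (x$1))\<^sup>2) = (cmod (x$1 - a))\<^sup>2"
    unfolding d_def k_def cmod_power2 minus_complex.sel times_complex.sel cnj.sel one_complex.sel by algebra
  have w: "cmod (x$1 * x$2 - x$3) \<le> 1 - (cmod (x$1))\<^sup>2" using bounds(4) by (smt (verit) norm_ge_zero)
  have dpos: "(cmod (d x))\<^sup>2 > 0" using d0[OF xc] by simp
  have kw: "k * cmod (x$1 * x$2 - x$3) \<le> k * (1 - (cmod (x$1))\<^sup>2)"
    using w k by (intro mult_left_mono) auto
  then have "k * cmod (x$1 * x$2 - x$3) \<le> (cmod (d x))\<^sup>2"
    using id by (smt (verit) zero_le_power2)
  then have "cmod (u x) \<le> 1" unfolding nu using dpos by simp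
  then have ux: "u x = p$3" using unit_disc_extreme[OF p3 _ ge] by simp
  then have "k * cmod (x$1 * x$2 - x$3) = (cmod (d x))\<^sup>2"
    using nu p3 dpos by simp
  with kw id have "(cmod (x$1 - a))\<^sup>2 \<le> 0" by linarith
  then have x1: "x$1 = a" by simp
  have "d x = of_real k" by (simp add: d_def k_def x1 complex_norm_square mult.commute flip: of_real_power)
  with \<open>k * cmod (x$1 * x$2 - x$3) = (cmod (d x))\<^sup>2\<close> have "cmod (x$1 * x$2 - x$3) = k"
    using k by (simp add: power2_eq_square)
  \<comment> \<open>The term \<open>|x1 x2 - x3|\<close> already exhausts the bound, so
    \<open>x2 - cnj a * x3\<close> must vanish.\<close>
  with bounds(4) have x2: "x$2 = cnj a * x$3" by (simp add: x1 k_def)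
  have "x$3 - x$1 * x$2 = of_real k * x$3"
    by (simp add: x1 x2 k_def complex_norm_square algebra_simps flip: of_real_power)
  then have "u x = of_real k * (of_real k * x$3) * (inverse (of_real k) * inverse (of_real k))"
    by (simp only: u_def \<open>d x = of_real k\<close>)
  with ux have "x$3 = p$3" using k by (simp add: field_simps)
  then have "x = p" using x1 x2 p2 by (simp add: vec_eq_iff forall_3 a_def)
  with x(1) show ?thesis by simp
qed

text \<open>A sum of three numbers of modulus at most 1 reaches modulus 3 only if they agree, which
  fixes \<open>x1\<close> and \<open>x2\<close>. Since \<open>|x1| = 1\<close>, the last closure
  bound then forces \<open>x3 = x1 x2\<close>.\<close>

lemma triangular_mem_boundary:
  assumes p: "p \<in> shilov" and eq: "cmod (p$1) = 1" and B: "is_boundary tetrablock B"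
  shows "p \<in> B"
proof -
  have p1: "p$1 * cnj (p$1) = 1" and p2: "p$2 * cnj (p$2) = 1"
    using shilovD(2)[OF p] eq unimodular_cnj by metis+
  note p3 = shilovD(1)[OF p]
  define f where "f x = 1 + cnj (p$1) * x$1 + cnj (p$2) * x$2" for x :: "complex^3"
  have "holomorphic_several_on f tetrablock"
    unfolding f_def
    by (intro holomorphic_several_on_add holomorphic_several_on_mult holomorphic_several_on_const
        holomorphic_several_on_nth)
  moreover have "continuous_on (closure tetrablock) f"
    unfolding f_def by (intro continuous_intros)
  ultimately have "f \<in> alg_A tetrablock" by (simp add: alg_A_def)
  then obtain x where x: "x \<in> B" "\<And>y. y \<in> closure tetrablock \<Longrightarrow> cmod (f y) \<le> cmod (f x)"
    using B unfolding is_boundary_def by blast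
  have xc: "x \<in> closure tetrablock" using B x(1) by (auto simp: is_boundary_def)
  note bounds = closure_tetrablock_bounds[OF xc]
  have "f p = 3" using p1 p2 by (simp add: f_def mult.commute)
  then have ge: "3 \<le> cmod (1 + cnj (p$1) * x$1 + cnj (p$2) * x$2)"
    using x(2)[of p] shilov_subset p unfolding \<open>f p = 3\<close> by (auto simp: f_def)
  have "cmod (cnj (p$1) * x$1) \<le> 1" "cmod (cnj (p$2) * x$2) \<le> 1"
    using bounds eq shilovD[OF p] by (simp_all add: norm_mult)
  from unit_disc_extreme3[OF this ge] have "cnj (p$1) * x$1 = 1" "cnj (p$2) * x$2 = 1" .
  then have "p$1 * (cnj (p$1) * x$1) = p$1" "p$2 * (cnj (p$2) * x$2) = p$2" by simp_all
  then have x1: "x$1 = p$1" and x2: "x$2 = p$2"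
    using p1 p2 by (simp_all add: mult.assoc[symmetric])
  from bounds(4) eq x1 have "x$1 * x$2 = x$3" by (smt (verit) norm_ge_zero norm_eq_zero right_minus_eq one_power2)
  moreover have "p$1 * p$2 = p$3" unfolding p3 using p1 by (simp add: mult.assoc[symmetric])
  ultimately have "x = p" using x1 x2 by (simp add: vec_eq_iff forall_3)
  with x(1) show ?thesis by simp
qed

text \<open>\<open>K\<close> is a closed boundary, and the two peak arguments place each of its
  points in every competitor.\<close>

lemma distinguished_boundary_tetrablock: "distinguished_boundary tetrablock = shilov"
  unfolding distinguished_boundary_def
proof (rule Least_equality)
  show "closed shilov \<and> is_boundary tetrablock shilov"
    using closed_shilov is_boundary_shilov by simp
  show "shilov \<le> B" if "closed B \<and> is_boundary tetrablock B" for B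
  proof
    fix p assume p: "p \<in> shilov"
    then have "cmod (p$1) < 1 \<or> cmod (p$1) = 1" by (auto simp: shilov_def)
    with p that show "p \<in> B"
      using triangular_mem_boundary nontriangular_mem_boundary by blast
  qed
qed

section \<open>The orbits of the automorphism group\<close>

text \<open>The denominators of the two conventions differ by a sign, which the minus sign of the
  parametrization absorbs.\<close>

lemma minus_blaschke_eq: "- c * blaschke a z = c * Moebius_function 0 a z"
proof -
  have "(z - a) / (cnj a * z - 1) = - ((z - a) / (1 - cnj a * z))"
    by (metis minus_diff_eq minus_divide_right)
  then show ?thesis by (simp add: blaschke_def Moebius_function_simple)
qed

text \<open>With \<open>a\<close> the zero of \<open>v\<close>, both \<open>v \<circ> N\<close> and
  its inverse \<open>M \<circ> w\<close> fix 0. The Schwarz lemma for both shows that moduli are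
  preserved, and its equality case makes \<open>v \<circ> N\<close> a rotation.\<close>

lemma Aut_disc_imp_blaschke:
  assumes v: "v \<in> Aut_disc"
  obtains \<xi> a where "\<xi> \<in> sphere 0 1" "a \<in> disc" "\<And>z. z \<in> disc \<Longrightarrow> v z = - \<xi> * blaschke a z"
proof -
  define w where "w = inv_into disc v"
  define a where "a = w 0"
  have bij: "bij_betw v disc disc" and vhol: "v holomorphic_on disc" and whol: "w holomorphic_on disc"
    using v by (auto simp: Aut_disc_def w_def)
  have v_in: "v z \<in> disc" and w_in: "w z \<in> disc" and vw: "v (w z) = z" and wv: "w (v z) = z"
    if "z \<in> disc" for z
    using that bij bij_betw_inv_into[OF bij] unfolding w_def
    by (blast intro: bij_betwE[THEN bspec] bij_betw_inv_into_left bij_betw_inv_into_right)+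
  have a: "cmod a < 1" using w_in[of 0] by (simp add: a_def)
  define M where "M = Moebius_function 0 a"
  define N where "N = Moebius_function 0 (- a)"
  have Mhol: "M holomorphic_on disc" and Nhol: "N holomorphic_on disc"
    unfolding M_def N_def using a by (auto intro: Moebius_function_holomorphic)
  have M_in: "M z \<in> disc" and N_in: "N z \<in> disc" if "z \<in> disc" for z
    using that a by (simp_all add: M_def N_def Moebius_function_norm_lt_1)
  have MN: "M (N z) = z" and NM: "N (M z) = z" if "z \<in> disc" for z
    using that a by (simp_all add: M_def N_def Moebius_function_compose)
  have N0: "N 0 = a" and Ma: "M a = 0"
    by (simp_all add: M_def N_def Moebius_function_of_zero Moebius_function_eq_zero)
  have va: "v a = 0" using vw[of 0] by (simp add: a_def)
  have g: "v \<circ> N holomorphic_on disc" "(v \<circ> N) 0 = 0" "cmod z < 1 \<Longrightarrow> cmod ((v \<circ> N) z) < 1" for z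
    using N_in v_in N0 va
    by (auto intro!: holomorphic_on_compose_gen[OF Nhol vhol] simp: image_subset_iff)
  have h: "M \<circ> w holomorphic_on disc" "(M \<circ> w) 0 = 0" "cmod z < 1 \<Longrightarrow> cmod ((M \<circ> w) z) < 1" for z
    using M_in w_in Ma
    by (auto intro!: holomorphic_on_compose_gen[OF whol Mhol] simp: image_subset_iff a_def)
  \<comment> \<open>One nonzero point is enough for the equality case; \<open>1/2\<close> is an
    arbitrary choice.\<close>
  have g_half: "cmod ((v \<circ> N) (1/2)) = cmod (1/2)"
  proof (rule antisym)
    have half: "1/2 \<in> disc" by simp
    show "cmod ((v \<circ> N) (1/2)) \<le> cmod (1/2)"
      by (rule Schwarz_Lemma(1)[OF g]) auto
    have "cmod ((M \<circ> w) ((v \<circ> N) (1/2))) \<le> cmod ((v \<circ> N) (1/2))"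
      by (rule Schwarz_Lemma(1)[OF h]) (use g(3)[of "1/2"] in auto)
    moreover have "(M \<circ> w) ((v \<circ> N) (1/2)) = 1/2"
      using wv[OF N_in[OF half]] MN[OF half] by simp
    ultimately show "cmod (1/2) \<le> cmod ((v \<circ> N) (1/2))" by (simp only:)
  qed
  have "\<exists>\<alpha>. (\<forall>z. cmod z < 1 \<longrightarrow> (v \<circ> N) z = \<alpha> * z) \<and> cmod \<alpha> = 1"
    by (rule Schwarz_Lemma(3)[OF g, of 0])
      (use g_half in \<open>auto intro!: exI[of _ "1/2"]\<close>)
  then obtain \<alpha> where \<alpha>: "\<And>z. cmod z < 1 \<Longrightarrow> (v \<circ> N) z = \<alpha> * z" "cmod \<alpha> = 1"
    by blast
  show thesis
  proof
    show "\<alpha> \<in> sphere 0 1" "a \<in> disc" using \<alpha> a by auto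
    show "v z = - \<alpha> * blaschke a z" if z: "z \<in> disc" for z
      using \<alpha>(1)[of "M z"] M_in[OF z] NM[OF z] by (simp only: minus_blaschke_eq M_def) simp
  qed
qed

lemma blaschke_in_Aut_disc:
  assumes "\<xi> \<in> sphere 0 1" "a \<in> disc"
  shows "(\<lambda>z. - \<xi> * blaschke a z) \<in> Aut_disc"
proof -
  define f where "f = (\<lambda>z. \<xi> * Moebius_function 0 a z)"
  define g where "g = (\<lambda>z. Moebius_function 0 (- a) (cnj \<xi> * z))"
  have \<xi>: "cmod \<xi> = 1" "\<xi> * cnj \<xi> = 1" "cnj \<xi> * \<xi> = 1" and a: "cmod a < 1"
    using assms unimodular_cnj[of \<xi>] by (auto simp: mult.commute)
  have f_in: "f z \<in> disc" and g_in: "g z \<in> disc" if "z \<in> disc" for z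
    using that \<xi> a by (simp_all add: f_def g_def norm_mult Moebius_function_norm_lt_1)
  have gf: "g (f z) = z" and fg: "f (g z) = z" if "z \<in> disc" for z
    using that \<xi> a
    by (simp_all add: f_def g_def mult.assoc[symmetric] Moebius_function_compose norm_mult)
  have bij: "bij_betw f disc disc"
    by (rule bij_betw_byWitness[of _ g]) (use f_in g_in gf fg in auto)
  have fhol: "f holomorphic_on disc"
    unfolding f_def using a by (intro holomorphic_intros Moebius_function_holomorphic)
  have "Moebius_function 0 (- a) \<circ> (\<lambda>z. cnj \<xi> * z) holomorphic_on disc"
    using a \<xi> by (intro holomorphic_on_compose_gen[where t = disc] holomorphic_intros Moebius_function_holomorphic)
      (auto simp: norm_mult)
  then have ghol: "g holomorphic_on disc" by (simp add: g_def o_def)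
  have "inv_into disc f holomorphic_on disc"
  \<comment> \<open>The inverse is \<open>g\<close> on the disc: undo the rotation, then apply the
    Moebius map with parameter \<open>- a\<close>.\<close>
  proof (rule holomorphic_transform[OF ghol])
    fix z assume "z \<in> disc"
    then show "g z = inv_into disc f z"
      using bij g_in fg by (metis bij_betw_imp_inj_on inv_into_f_f)
  qed
  with bij fhol have "f \<in> Aut_disc" by (simp add: Aut_disc_def)
  then show ?thesis by (simp only: f_def minus_blaschke_eq)
qed

section \<open>The explicit formula at \<open>(1, 1, 1)\<close> and \<open>(0, 0, 1)\<close>\<close>

lemma one_minus_ne_0:
  fixes z :: complex
  assumes "cmod z < 1"
  shows "1 - z \<noteq> 0" "1 + z \<noteq> 0"
proof -
  show "1 - z \<noteq> 0" using assms by auto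
  show "1 + z \<noteq> 0" using assms by (metis add.inverse_inverse minus_add_cancel norm_minus_cancel norm_one add_eq_0_iff less_irrefl)
qed

text \<open>Numerators and denominator factor through \<open>p\<close>, \<open>q\<close> and their
  conjugates, so the first two coordinates are unimodular quotients and the third is their
  product.\<close>

lemma T_formula_ones:
  assumes "cmod \<xi>1 = 1" "cmod \<xi>2 = 1" "cmod z1 < 1" "cmod z2 < 1"
  defines "x \<equiv> T_formula \<xi>1 z1 \<xi>2 z2 (vector [1, 1, 1])"
  shows "x \<in> shilov" "cmod (x$1) = 1"
proof -
  define p q where "p = 1 - z1" and "q = 1 - cnj \<xi>2 * z2"
  have "p \<noteq> 0" "q \<noteq> 0"
    unfolding p_def q_def by (rule one_minus_ne_0(1); use assms in \<open>simp add: norm_mult\<close>)+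
  then have p: "p \<noteq> 0" "cnj p \<noteq> 0" and q: "q \<noteq> 0" "cnj q \<noteq> 0" by simp_all
  have \<xi>: "\<xi>2 * cnj \<xi>2 = 1" using unimodular_cnj assms by simp
  have d: "(1 - cnj z1) - \<xi>2 * cnj z2 * (1 - cnj z1) = cnj p * cnj q"
    by (simp add: p_def q_def algebra_simps)
  have \<xi>q: "\<xi>2 * q = \<xi>2 - z2"
    unfolding q_def right_diff_distrib mult.assoc[symmetric] \<xi> by simp
  have n1: "(1 - z1) + \<xi>2 * cnj z2 * (z1 - 1) = p * cnj q"
    by (simp add: p_def q_def algebra_simps)
  have n2: "z2 * (cnj z1 - 1) + \<xi>2 * (1 - cnj z1) = cnj p * (\<xi>2 * q)"
    unfolding \<xi>q by (simp add: p_def algebra_simps)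
  have n3: "z2 * (z1 - 1) - \<xi>2 * (z1 - 1) = p * (\<xi>2 * q)"
    unfolding \<xi>q by (simp add: p_def algebra_simps)
  have x1: "x$1 = \<xi>1 * (p / cnj p)" and x2: "x$2 = \<xi>2 * (q / cnj q)" and x3: "x$3 = \<xi>1 * (p / cnj p) * (\<xi>2 * (q / cnj q))"
    using p q by (simp_all add: x_def T_formula_def d n1 n2 n3)
  show 1: "cmod (x$1) = 1" using p assms(1-4) by (simp add: x1 norm_mult norm_divide)
  have 2: "cmod (x$2) = 1" using q assms(1-4) by (simp add: x2 norm_mult norm_divide)
  have 3: "x$3 = x$1 * x$2" by (simp add: x1 x2 x3)
  have "cnj (x$2) * x$3 = x$1 * (x$2 * cnj (x$2))" unfolding 3 by (simp add: mult_ac)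
  with 1 2 show "x \<in> shilov" by (simp add: shilov_def 3 norm_mult unimodular_cnj)
qed

text \<open>With \<open>w = \<xi>2 * cnj z2\<close>, the first coordinate is a rotated value
  \<open>(z1 + w) / (1 + cnj z1 * w)\<close> at two points of the disc, hence again in the disc. The
  third is a rotation of \<open>cnj d / d\<close>.\<close>

lemma T_formula_e3:
  assumes "cmod \<xi>1 = 1" "cmod \<xi>2 = 1" "cmod z1 < 1" "cmod z2 < 1"
  defines "x \<equiv> T_formula \<xi>1 z1 \<xi>2 z2 (vector [0, 0, 1])"
  shows "x \<in> shilov" "cmod (x$1) < 1"
proof -
  define w where "w = \<xi>2 * cnj z2"
  define d where "d = 1 + cnj z1 * w"
  have w: "cmod w < 1" using assms by (simp add: w_def norm_mult)
  have "cmod (cnj z1 * w) < 1" using assms w norm_mult_less[of "cnj z1" 1 w 1] by simp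
  then have "d \<noteq> 0" unfolding d_def by (rule one_minus_ne_0)
  then have d0: "d \<noteq> 0" "cnj d \<noteq> 0" by simp_all
  have \<xi>: "\<xi>2 * cnj \<xi>2 = 1" using unimodular_cnj assms by simp
  have wz: "\<xi>2 * cnj w = z2" using \<xi> by (simp add: w_def mult.assoc[symmetric])
  have d: "(1 - cnj z1 * 0) - \<xi>2 * cnj z2 * (0 - cnj z1 * 1) = d"
    by (simp add: d_def w_def)
  have n1: "(0 - z1) + \<xi>2 * cnj z2 * (z1 * 0 - 1) = - (z1 + w)" by (simp add: w_def)
  have n2: "z2 * (cnj z1 * 0 - 1) + \<xi>2 * (0 - cnj z1 * 1) = - (\<xi>2 * cnj (z1 + w))"
    unfolding complex_cnj_add distrib_left wz by simp
  have n3: "z2 * (z1 - 0) - \<xi>2 * (z1 * 0 - 1) = \<xi>2 * cnj d"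
    using wz by (simp add: d_def distrib_left mult.commute mult.left_commute)
  have x1: "x$1 = - \<xi>1 * ((z1 + w) / d)"
    unfolding x_def T_formula_def Let_def vector_3 d n1
    by (simp only: mult_minus_left mult_minus_right minus_divide_left[symmetric] times_divide_eq_right)
  have x2: "x$2 = - \<xi>2 * (cnj (z1 + w) / d)"
    unfolding x_def T_formula_def Let_def vector_3 d n2
    by (simp only: mult_minus_left mult_minus_right minus_divide_left[symmetric] times_divide_eq_right)
  have x3: "x$3 = \<xi>1 * \<xi>2 * (cnj d / d)"
    unfolding x_def T_formula_def Let_def vector_3 d n3 by simp
  show lt: "cmod (x$1) < 1"
  proof -
    have "(cmod d)\<^sup>2 - (cmod (z1 + w))\<^sup>2 = (1 - (cmod z1)\<^sup>2) * (1 - (cmod w)\<^sup>2)"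
      unfolding d_def cmod_power2 plus_complex.sel times_complex.sel cnj.sel one_complex.sel by algebra
    moreover have "(1 - (cmod z1)\<^sup>2) * (1 - (cmod w)\<^sup>2) > 0"
      using assms w by (simp add: abs_square_less_1)
    ultimately have "(cmod (z1 + w))\<^sup>2 < (cmod d)\<^sup>2" by linarith
    then have "cmod (z1 + w) < cmod d" by (rule power2_less_imp_less) simp
    then show ?thesis using assms(1-4) d0 by (simp add: x1 norm_mult norm_divide)
  qed
  have 3: "cmod (x$3) = 1" using d0 assms(1-4) by (simp add: x3 norm_mult norm_divide)
  have "cnj (x$2) * x$3 = - (\<xi>2 * cnj \<xi>2) * \<xi>1 * ((z1 + w) / cnj d * (cnj d / d))"
    by (simp add: x2 x3)
  also have "\<dots> = x$1" using d0 by (simp add: \<xi> x1)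
  finally show "x \<in> shilov" using lt 3 by (simp add: shilov_def)
qed

lemma T_aut_params:
  assumes "v \<in> Aut_disc" "\<kappa> \<in> Aut_disc"
  obtains \<xi>1 z1 \<xi>2 z2 where "cmod \<xi>1 = 1" "cmod \<xi>2 = 1" "cmod z1 < 1" "cmod z2 < 1"
    "T_aut v \<kappa> = T_formula \<xi>1 z1 \<xi>2 z2"
proof -
  obtain \<xi>1 z1 where 1: "\<xi>1 \<in> sphere 0 1" "z1 \<in> disc" "\<And>z. z \<in> disc \<Longrightarrow> v z = - \<xi>1 * blaschke z1 z"
    using Aut_disc_imp_blaschke[OF assms(1)] by blast
  obtain \<xi>2 a where 2: "\<xi>2 \<in> sphere 0 1" "a \<in> disc" "\<And>z. z \<in> disc \<Longrightarrow> \<kappa> z = - \<xi>2 * blaschke a z"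
    using Aut_disc_imp_blaschke[OF assms(2)] by blast
  show thesis
  proof
    \<comment> \<open>The zero of \<open>\<kappa>\<close> is written as \<open>- cnj z2\<close>, so
      \<open>z2 = - cnj a\<close>.\<close>
    show "T_aut v \<kappa> = T_formula \<xi>1 z1 \<xi>2 (- cnj a)"
      by (rule ext, rule T_aut_eq) (use 1 2 in auto)
  qed (use 1 2 in auto)
qed

lemma T_formula_eq_T_aut:
  assumes "cmod \<xi>1 = 1" "cmod \<xi>2 = 1" "cmod z1 < 1" "cmod z2 < 1"
  obtains v \<kappa> where "v \<in> Aut_disc" "\<kappa> \<in> Aut_disc" "T_aut v \<kappa> = T_formula \<xi>1 z1 \<xi>2 z2"
proof
  show "(\<lambda>z. - \<xi>1 * blaschke z1 z) \<in> Aut_disc" "(\<lambda>z. - \<xi>2 * blaschke (- cnj z2) z) \<in> Aut_disc"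
    by (rule blaschke_in_Aut_disc; use assms in simp)+
  show "T_aut (\<lambda>z. - \<xi>1 * blaschke z1 z) (\<lambda>z. - \<xi>2 * blaschke (- cnj z2) z) = T_formula \<xi>1 z1 \<xi>2 z2"
    by (rule ext, rule T_aut_eq) (use assms in auto)
qed

lemma T_aut_orbit_ones:
  "{T_aut v \<kappa> (vector [1, 1, 1]) | v \<kappa>. v \<in> Aut_disc \<and> \<kappa> \<in> Aut_disc} = {x \<in> shilov. cmod (x$1) = 1}"
proof (intro equalityI subsetI)
  fix x assume "x \<in> {T_aut v \<kappa> (vector [1, 1, 1]) | v \<kappa>. v \<in> Aut_disc \<and> \<kappa> \<in> Aut_disc}"
  then obtain v \<kappa> where v: "v \<in> Aut_disc" "\<kappa> \<in> Aut_disc" and x: "x = T_aut v \<kappa> (vector [1, 1, 1])"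
    by blast
  obtain \<xi>1 z1 \<xi>2 z2 where "cmod \<xi>1 = 1" "cmod \<xi>2 = 1" "cmod z1 < 1" "cmod z2 < 1"
    and "T_aut v \<kappa> = T_formula \<xi>1 z1 \<xi>2 z2"
    using T_aut_params[OF v] .
  with x show "x \<in> {x \<in> shilov. cmod (x$1) = 1}"
    by (simp add: T_formula_ones)
next
  fix x assume "x \<in> {x \<in> shilov. cmod (x$1) = 1}"
  then have x: "x \<in> shilov" "cmod (x$1) = 1" by auto
  \<comment> \<open>Rotations suffice: for \<open>z1 = z2 = 0\<close> the image of
    \<open>(1, 1, 1)\<close> is \<open>(\<xi>1, \<xi>2, \<xi>1 * \<xi>2)\<close>.\<close>
  then obtain v \<kappa> where v: "v \<in> Aut_disc" "\<kappa> \<in> Aut_disc" "T_aut v \<kappa> = T_formula (x$1) 0 (x$2) 0"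
    using T_formula_eq_T_aut[of "x$1" "x$2" 0 0] shilovD(2) by auto
  have "x$1 * x$2 = x$3"
    using shilovD(1)[OF x(1)] unimodular_cnj[OF x(2)] by (simp add: mult.assoc[symmetric])
  then have "x = T_aut v \<kappa> (vector [1, 1, 1])"
    by (simp add: v(3) T_formula_def vec_eq_iff forall_3)
  with v show "x \<in> {T_aut v \<kappa> (vector [1, 1, 1]) | v \<kappa>. v \<in> Aut_disc \<and> \<kappa> \<in> Aut_disc}"
    by blast
qed

lemma T_aut_orbit_e3:
  "{T_aut v \<kappa> (vector [0, 0, 1]) | v \<kappa>. v \<in> Aut_disc \<and> \<kappa> \<in> Aut_disc} = {x \<in> shilov. cmod (x$1) < 1}"
proof (intro equalityI subsetI)
  fix x assume "x \<in> {T_aut v \<kappa> (vector [0, 0, 1]) | v \<kappa>. v \<in> Aut_disc \<and> \<kappa> \<in> Aut_disc}"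
  then obtain v \<kappa> where v: "v \<in> Aut_disc" "\<kappa> \<in> Aut_disc" and x: "x = T_aut v \<kappa> (vector [0, 0, 1])"
    by blast
  obtain \<xi>1 z1 \<xi>2 z2 where "cmod \<xi>1 = 1" "cmod \<xi>2 = 1" "cmod z1 < 1" "cmod z2 < 1"
    and "T_aut v \<kappa> = T_formula \<xi>1 z1 \<xi>2 z2"
    using T_aut_params[OF v] .
  with x show "x \<in> {x \<in> shilov. cmod (x$1) < 1}"
    by (simp add: T_formula_e3)
next
  fix x assume "x \<in> {x \<in> shilov. cmod (x$1) < 1}"
  then have x: "x \<in> shilov" "cmod (x$1) < 1" by auto
  \<comment> \<open>For \<open>\<xi>1 = 1\<close> and \<open>z2 = 0\<close> the image of
    \<open>(0, 0, 1)\<close> is \<open>(- z1, - \<xi>2 * cnj z1, \<xi>2)\<close>, which dictates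
    \<open>z1\<close> and \<open>\<xi>2\<close>.\<close>
  then obtain v \<kappa> where v: "v \<in> Aut_disc" "\<kappa> \<in> Aut_disc" "T_aut v \<kappa> = T_formula 1 (- x$1) (x$3) 0"
    using T_formula_eq_T_aut[of 1 "x$3" "- x$1" 0] by (auto simp: shilov_def)
  have "x = T_aut v \<kappa> (vector [0, 0, 1])"
    using shilovD(1)[OF x(1)] by (simp add: v(3) T_formula_def vec_eq_iff forall_3 mult.commute)
  with v show "x \<in> {T_aut v \<kappa> (vector [0, 0, 1]) | v \<kappa>. v \<in> Aut_disc \<and> \<kappa> \<in> Aut_disc}"
    by blast
qed

text \<open>On \<open>K\<close> one has \<open>x1 x2 = |x1|^2 x3\<close> with \<open>x3\<close>
  nonzero.\<close>

lemma shilov_triangular_iff: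
  assumes "x \<in> shilov"
  shows "x \<in> triangular_points \<longleftrightarrow> cmod (x$1) = 1"
proof -
  have "x$1 * x$2 = of_real ((cmod (x$1))\<^sup>2) * x$3"
    unfolding complex_norm_square using shilovD(1)[OF assms] by (simp add: mult.assoc)
  moreover have "x$3 \<noteq> 0" using assms by (auto simp: shilov_def)
  ultimately have "x$1 * x$2 = x$3 \<longleftrightarrow> cmod (x$1) = 1"
    by (simp add: abs_square_eq_1 del: of_real_power)
  then show ?thesis
    using assms shilov_subset by (auto simp: triangular_points_def)
qed

theorem theorem2p6:
  "distinguished_boundary tetrablock =
      (\<Union>v\<in>Aut_disc. \<Union>\<kappa>\<in>Aut_disc. {T_aut v \<kappa> (vector [0, 0, 1]), T_aut v \<kappa> (vector [1, 1, 1])}) \<and>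
   distinguished_boundary tetrablock \<inter> triangular_points =
      {T_aut v \<kappa> (vector [1, 1, 1]) | v \<kappa>. v \<in> Aut_disc \<and> \<kappa> \<in> Aut_disc} \<and>
   distinguished_boundary tetrablock - triangular_points =
      {T_aut v \<kappa> (vector [0, 0, 1]) | v \<kappa>. v \<in> Aut_disc \<and> \<kappa> \<in> Aut_disc}"
proof -
  have le: "cmod (x$1) \<le> 1" if "x \<in> shilov" for x using that unfolding shilov_def by blast
  have "(\<Union>v\<in>Aut_disc. \<Union>\<kappa>\<in>Aut_disc. {T_aut v \<kappa> (vector [0, 0, 1]), T_aut v \<kappa> (vector [1, 1, 1])}) =
      {T_aut v \<kappa> (vector [0, 0, 1]) | v \<kappa>. v \<in> Aut_disc \<and> \<kappa> \<in> Aut_disc} \<union>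
      {T_aut v \<kappa> (vector [1, 1, 1]) | v \<kappa>. v \<in> Aut_disc \<and> \<kappa> \<in> Aut_disc}"
    by blast
  also have "\<dots> = shilov"
    unfolding T_aut_orbit_ones T_aut_orbit_e3 using le by force
  finally show ?thesis
    unfolding distinguished_boundary_tetrablock T_aut_orbit_ones T_aut_orbit_e3
    using shilov_triangular_iff le by force
qed

end
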